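(* The bivariate generating function for the total number of partial Łukasiewicz paths of length $n$ (length marked by $z$) with respect to the height of the end point (marked by $u$) is given by $$\mathit{Total}(z,u)=1+\frac{-1+\sqrt{1-4z}}{2u-1-\sqrt{1-4z}},$$ and we have $$[u^k]\mathit{Total}(z,u)=[k=0]+zL(z)^{k+2}.$$ Finally, for $n\ge 1$, $$[z^n][u^k]\mathit{Total}(z,u)=\frac{k+2}{n+k+1}\binom{2n+k-1}{n-1},$$ $$[z^n][u^k]F(u)=\frac{k}{n+k-1}\binom{2n+k-3}{n-1},$$ $$[z^n][u^k]G(u)=\frac{k+3}{n+k+1}\binom{2n+k-2}{n-2},$$ $$[z^n][u^k]H(u)=\frac{k+2}{n+k}\binom{2n+k-3}{n-2}.$$
   Context: A Łukasiewicz path of length $n\ge 0$ is a lattice path in $\mathbb{N}^2$ starting at the origin $(0,0)$, ending on the $x$-axis, and consisting of $n$ steps from $\{(1,j): j\ge -1\}$ (so it never goes below the $x$-axis). A partial Łukasiewicz path of length $n$ is a prefix with $n$ steps of a Łukasiewicz path. The height of a point is its $y$-coordinate. The step $(1,-1)$ is a down-step, $(1,0)$ is a horizontal step, and $(1,j)$ with $j\ge 1$ is an up-step. $L(z)=\frac{1-\sqrt{1-4z}}{2z}$ is the generating function of Łukasiewicz paths with respect to length. The index $k$ ranges over integers $k\ge 0$. $F(u)=F(u,z)=\sum_{k\ge0}u^kf_k(z)$, $G(u)=G(u,z)=\sum_{k\ge0}u^kg_k(z)$, $H(u)=H(u,z)=\sum_{k\ge0}u^kh_k(z)$, where the coefficient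 of $z^n$ in $f_k$ (resp. $g_k$, $h_k$) is the number of partial Łukasiewicz paths of length $n$ ending at height $k$ whose last step is an up-step (resp. a down-step, a horizontal step). The empty path is counted in $f_0$, so $f_0=1$. $\mathit{Total}(z,u)=F(u)+G(u)+H(u)$ counts all partial Łukasiewicz paths. $\sqrt{1-4z}$ is the formal power series with constant term $1$; rational expressions are expanded as power series in $u$ whose coefficients are power series in $z$. $[x^m]$ denotes extraction of the coefficient of $x^m$, and $[k=0]$ equals $1$ if $k=0$ and $0$ otherwise.
   Formalization: At n=1, k=0 the printed formula for H gives 2·binom(-1,-1) (0 or 2), but the true coefficient is 1, so the value 1 is stated there instead; the printed formula for F at n=1, k=0 is 0/0 and is read as 0, the true count. *)

theory Defs
  imports Complex_Main "HOL-Computational_Algebra.Formal_Power_Series"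
begin

unbundle fps_syntax

text \<open>A path is encoded by the list of the second components \<open>j \<ge> -1\<close> of its steps \<open>(1, j)\<close>;
  the height after \<open>i\<close> steps is the sum of the first \<open>i\<close> entries.\<close>

definition luka_path :: "int list \<Rightarrow> bool" where
  "luka_path s \<longleftrightarrow>
     (\<forall>j\<in>set s. j \<ge> -1) \<and> (\<forall>i\<le>length s. sum_list (take i s) \<ge> 0) \<and> sum_list s = 0"

definition partial_luka_path :: "int list \<Rightarrow> bool" where
  "partial_luka_path s \<longleftrightarrow> (\<exists>t. luka_path (s @ t))"

definition partial_paths :: "(int list \<Rightarrow> bool) \<Rightarrow> nat \<Rightarrow> nat \<Rightarrow> int list set" where
  "partial_paths P n k =
     {s. partial_luka_path s \<and> length s = n \<and> sum_list s = int k \<and> P s}"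

text \<open>A bivariate series is a power series in \<open>u\<close> (outer) with coefficients that are power
  series in \<open>z\<close> (inner): \<open>A $ k $ n\<close> is the coefficient of \<open>u^k z^n\<close>.\<close>

definition partial_gf :: "(int list \<Rightarrow> bool) \<Rightarrow> real fps fps" where
  "partial_gf P = Abs_fps (\<lambda>k. Abs_fps (\<lambda>n. of_nat (card (partial_paths P n k))))"

text \<open>By convention the empty path is counted together with the paths ending in an up-step.\<close>

definition F_gf :: "real fps fps" where
  "F_gf = partial_gf (\<lambda>s. s = [] \<or> last s \<ge> 1)"

definition G_gf :: "real fps fps" where
  "G_gf = partial_gf (\<lambda>s. s \<noteq> [] \<and> last s = -1)"

definition H_gf :: "real fps fps" where
  "H_gf = partial_gf (\<lambda>s. s \<noteq> [] \<and> last s = 0)"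

definition Total_gf :: "real fps fps" where
  "Total_gf = F_gf + G_gf + H_gf"

text \<open>\<open>sqrt (1 - 4z)\<close> with constant term \<open>root 2 1 = 1\<close>.\<close>

definition sqrt_fps :: "real fps" where
  "sqrt_fps = fps_radical root 2 (1 - 4 * fps_X)"

definition L_fps :: "real fps" where
  "L_fps = (1 - sqrt_fps) / (2 * fps_X)"

text \<open>Binomial coefficients with integer arguments, zero for a negative lower argument.  With
  natural-number subtraction, \<open>n - 2\<close> would be \<open>0\<close> at \<open>n = 1\<close> and give the wrong value.\<close>

definition binom :: "int \<Rightarrow> int \<Rightarrow> real" where
  "binom a b = (if b < 0 then 0 else of_int a gchoose nat b)"

lemma finite_partial_paths: "finite (partial_paths P n k)"
proof -
  have "partial_paths P n k \<subseteq> {s. set s \<subseteq> {-1..int (n + k)} \<and> length s = n}"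
  proof
    fix s assume s: "s \<in> partial_paths P n k"
    then have ge: "\<forall>j\<in>set s. j \<ge> -1"
      by (auto simp: partial_paths_def partial_luka_path_def luka_path_def)
    have bound: "x \<le> sum_list t + int (length t)" if "\<forall>j\<in>set t. j \<ge> -1" "x \<in> set t"
      for x :: int and t
      using that
    proof (induction t)
      case (Cons a t)
      have nn: "0 \<le> sum_list t + int (length t)"
        using Cons.prems(1) by (induction t) auto
      show ?case using Cons nn by (cases "x = a") auto
    qed simp
    show "s \<in> {s. set s \<subseteq> {-1..int (n + k)} \<and> length s = n}"
      using s ge bound[of s] by (auto simp: partial_paths_def add.commute)
  qed
  then show ?thesis
    by (rule finite_subset) (rule finite_lists_length_eq, simp)
qed

lemma Total_gf_counts_all: "Total_gf = partial_gf (\<lambda>_. True)"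
proof -
  let ?f = "\<lambda>s :: int list. s = [] \<or> last s \<ge> 1"
  let ?g = "\<lambda>s :: int list. s \<noteq> [] \<and> last s = -1"
  let ?h = "\<lambda>s :: int list. s \<noteq> [] \<and> last s = 0"
  have "card (partial_paths (\<lambda>_. True) n k) =
      card (partial_paths ?f n k) + card (partial_paths ?g n k) + card (partial_paths ?h n k)"
    for n k
  proof -
    have last: "s = [] \<or> last s \<ge> 1 \<or> last s = -1 \<or> last s = 0" if "partial_luka_path s" for s
    proof (cases "s = []")
      case False
      then have "last s \<ge> -1"
        using that last_in_set[of s] by (auto simp: partial_luka_path_def luka_path_def)
      then show ?thesis by linarith
    qed simp
    have "partial_paths (\<lambda>_. True) n k =
        (partial_paths ?f n k \<union> partial_paths ?g n k) \<union> partial_paths ?h n k"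
      using last by (auto simp: partial_paths_def)
    moreover have "card \<dots> = card (partial_paths ?f n k \<union> partial_paths ?g n k)
        + card (partial_paths ?h n k)"
      by (rule card_Un_disjoint) (auto simp: finite_partial_paths, auto simp: partial_paths_def)
    moreover have "card (partial_paths ?f n k \<union> partial_paths ?g n k) =
        card (partial_paths ?f n k) + card (partial_paths ?g n k)"
      by (rule card_Un_disjoint) (auto simp: finite_partial_paths, auto simp: partial_paths_def)
    ultimately show ?thesis by simp
  qed
  then show ?thesis
    by (simp add: fps_eq_iff Total_gf_def F_gf_def G_gf_def H_gf_def partial_gf_def)
qed

end

theory Submission
  imports Defs
begin

text \<open>
  Everything rests on removing the last step. A path ending at height \<open>k\<close> can be reached, by one
  legal step, from any height \<open>j \<le> k + 1\<close> and from no other, so the number \<open>T n k\<close> of partial paths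
  satisfies \<open>T (n + 1) k = (\<Sum>j\<le>k + 1. T n j)\<close> (lemma \<open>num_paths_Suc\<close>). In this sum \<open>j = k + 1\<close>
  belongs to a down-step, \<open>j = k\<close> to a horizontal step, and \<open>j < k\<close> to an up-step; hence the
  refined counts are \<open>T n (k + 1)\<close>, \<open>T n k\<close>, and what remains of \<open>T (n + 1) k\<close>.

  The recurrence determines \<open>T\<close>, and it is solved twice. On the level of power series in \<open>z\<close>, the
  equation \<open>L = 1 + z L\<^sup>2\<close> makes \<open>L\<^bsup>k+2\<^esup> - L\<^bsup>k+1\<^esup> = z L\<^bsup>k+3\<^esup>\<close>, and summing these differences
  shows that \<open>[k = 0] + z L\<^bsup>k+2\<^esup>\<close> solves it (\<open>Total_gf_nth_L\<close>); the fraction in \<open>u\<close>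
  is then the geometric series \<open>\<Sum>k. z L\<^bsup>k+2\<^esup> u\<^bsup>k\<^esup>\<close>. On the level of numbers, the same recurrence in
  differenced form, \<open>T (n + 1) (k + 1) - T (n + 1) k = T n (k + 2)\<close>, is verified for an explicit
  quotient of factorials (\<open>num_paths_eq_ballot\<close>). The coefficients of \<open>F\<close>, \<open>G\<close> and \<open>H\<close>
  follow from those of the total.
\<close>

section \<open>Decomposition of partial paths by the last step\<close>

text \<open>Every nonnegative path can be completed to a Lukasiewicz path, by descending to the axis.\<close>

lemma partial_luka_path_iff:
  "partial_luka_path s \<longleftrightarrow>
     (\<forall>j\<in>set s. j \<ge> -1) \<and> (\<forall>i\<le>length s. sum_list (take i s) \<ge> 0)"
  (is "_ \<longleftrightarrow> ?R")
proof
  assume "partial_luka_path s"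
  then obtain t where t: "luka_path (s @ t)"
    by (auto simp: partial_luka_path_def)
  have "sum_list (take i s) \<ge> 0" if "i \<le> length s" for i
  proof -
    have "sum_list (take i (s @ t)) \<ge> 0"
      using t that unfolding luka_path_def by (metis length_append trans_le_add1)
    then show ?thesis using that by simp
  qed
  then show ?R using t by (auto simp: luka_path_def)
next
  assume R: ?R
  define h where "h = nat (sum_list s)"
  have h: "int h = sum_list s"
    using R by (auto simp: h_def dest: spec[of _ "length s"])
  have pre: "sum_list (take i (s @ replicate h (-1))) \<ge> 0" for i
  proof (cases "i \<le> length s")
    case True
    then show ?thesis using R by simp
  next
    case False
    then show ?thesis
      using h by (simp add: sum_list_replicate min_def) linarith
  qed
  have "luka_path (s @ replicate h (-1))"
    unfolding luka_path_def using R h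
    by (intro conjI allI impI pre) (auto simp: sum_list_replicate)
  then show "partial_luka_path s"
    by (auto simp: partial_luka_path_def)
qed

lemma partial_luka_path_snoc:
  "partial_luka_path (s @ [j]) \<longleftrightarrow> partial_luka_path s \<and> j \<ge> -1 \<and> sum_list s + j \<ge> 0"
  by (auto simp: partial_luka_path_iff le_Suc_eq all_conj_distrib)

definition num_paths :: "nat \<Rightarrow> nat \<Rightarrow> nat" where
  "num_paths n k = card (partial_paths (\<lambda>_. True) n k)"

lemma num_paths_0: "num_paths 0 k = of_bool (k = 0)"
proof -
  have "partial_paths (\<lambda>_. True) 0 k = (if k = 0 then {[]} else {})"
    by (auto simp: partial_paths_def partial_luka_path_iff)
  then show ?thesis by (simp add: num_paths_def)
qed

text \<open>
  The summation index \<open>j\<close> is the height before the last step, which is therefore \<open>k - j\<close>; the only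
  restriction \<open>j \<le> k + 1\<close> comes from \<open>k - j \<ge> -1\<close>. Keeping a condition \<open>Q\<close> on the last step treats
  all paths and those with a prescribed kind of last step at once.
\<close>

lemma card_partial_paths_last_step:
  "card (partial_paths (\<lambda>s. s \<noteq> [] \<and> Q (last s)) (Suc n) k) =
     (\<Sum>j | j \<le> Suc k \<and> Q (int k - int j). num_paths n j)"
proof -
  let ?J = "{j. j \<le> Suc k \<and> Q (int k - int j)}"
  let ?A = "\<lambda>j. (\<lambda>s. s @ [int k - int j]) ` partial_paths (\<lambda>_. True) n j"
  have "partial_paths (\<lambda>s. s \<noteq> [] \<and> Q (last s)) (Suc n) k = (\<Union>j\<in>?J. ?A j)" (is "?P = ?U")
  proof
    show "?P \<subseteq> ?U"
    proof
      fix s assume s: "s \<in> ?P"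
      then obtain t x where tx: "s = t @ [x]"
        by (cases s rule: rev_cases) (auto simp: partial_paths_def)
      have t: "partial_luka_path t" "x \<ge> -1" "length t = n" "sum_list t + x = int k" "Q x"
        using s by (auto simp: tx partial_paths_def partial_luka_path_snoc)
      have "sum_list t \<ge> 0"
        using t(1) by (auto simp: partial_luka_path_iff dest: spec[of _ "length t"])
      then obtain j where j: "sum_list t = int j"
        using zero_le_imp_eq_int by blast
      have x: "x = int k - int j" using t j by simp
      have "j \<in> ?J" using t x by auto
      moreover have "s \<in> ?A j"
        using t j by (auto simp: tx x partial_paths_def)
      ultimately show "s \<in> ?U" by blast
    qed
    show "?U \<subseteq> ?P"
      by (auto simp: partial_paths_def partial_luka_path_snoc)
  qed
  moreover have "card ?U = (\<Sum>j\<in>?J. card (?A j))"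
    by (rule card_UN_disjoint) (auto simp: finite_partial_paths)
  moreover have "card (?A j) = num_paths n j" for j
    by (simp add: num_paths_def card_image inj_on_def)
  ultimately show ?thesis by simp
qed

lemma num_paths_Suc: "num_paths (Suc n) k = (\<Sum>j\<le>Suc k. num_paths n j)"
proof -
  have "partial_paths (\<lambda>_. True) (Suc n) k = partial_paths (\<lambda>s. s \<noteq> [] \<and> True) (Suc n) k"
    by (auto simp: partial_paths_def)
  then show ?thesis
    using card_partial_paths_last_step[of "\<lambda>_. True" n k]
    by (simp add: num_paths_def atMost_def)
qed

section \<open>Coefficients of the four series in terms of the path numbers\<close>

lemma Total_gf_nth: "Total_gf $ k $ n = real (num_paths n k)"
  by (simp add: Total_gf_counts_all partial_gf_def num_paths_def)

lemma G_gf_nth_Suc: "G_gf $ k $ Suc n = real (num_paths n (Suc k))"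
proof -
  have "{j. j \<le> Suc k \<and> int k - int j = -1} = {Suc k}" by auto
  then show ?thesis
    using card_partial_paths_last_step[of "\<lambda>x. x = -1" n k]
    by (simp add: G_gf_def partial_gf_def)
qed

lemma H_gf_nth_Suc: "H_gf $ k $ Suc n = real (num_paths n k)"
proof -
  have "{j. j \<le> Suc k \<and> int k - int j = 0} = {k}" by auto
  then show ?thesis
    using card_partial_paths_last_step[of "\<lambda>x. x = 0" n k]
    by (simp add: H_gf_def partial_gf_def)
qed

lemma F_gf_nth_Suc:
  "F_gf $ k $ Suc n = real (num_paths (Suc n) k) - real (num_paths n k) - real (num_paths n (Suc k))"
  using Total_gf_nth[of k "Suc n"] G_gf_nth_Suc[of k n] H_gf_nth_Suc[of k n]
  by (simp add: Total_gf_def)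

section \<open>A closed form for the path numbers\<close>

text \<open>
  The number of partial paths of length \<open>n + 1\<close>, not \<open>n\<close>: the uniform formula fails for the empty
  path. The quotient of factorials is the ballot number \<open>(k + 2) / (n + k + 2) * (2n + k + 1 choose n)\<close>
  in a form in which the recurrences become identities of rational functions.
\<close>

definition ballot :: "nat \<Rightarrow> nat \<Rightarrow> real" where
  "ballot n k = (real k + 2) * fact (2 * n + k + 1) / (fact n * fact (n + k + 2))"

lemma ballot_binomial:
  "ballot n k = (real k + 2) / (real n + real k + 2) * real ((2 * n + k + 1) choose n)"
proof -
  have "2 * n + k + 1 - n = n + k + 1" by simp
  then have "real ((2 * n + k + 1) choose n) = fact (2 * n + k + 1) / (fact n * fact (n + k + 1))"
    using binomial_fact[of n "2 * n + k + 1", where ?'a = real] by (simp del: fact_Suc)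
  moreover have "fact (n + k + 2) = (real n + real k + 2) * fact (n + k + 1)"
    by (simp add: algebra_simps)
  ultimately show ?thesis by (simp only: ballot_def times_divide_times_eq mult_ac)
qed

lemma ballot_rec_0: "ballot (Suc n) 0 = ballot n 0 + ballot n 1"
proof -
  have "fact (2 * Suc n + 1) = (2 * real n + 3) * (2 * real n + 2) * fact (2 * n + 1)"
    "fact (2 * n + 1 + 1) = (2 * real n + 2) * fact (2 * n + 1)"
    "fact (Suc n + 2) = (real n + 3) * fact (n + 2)"
    "fact (n + 1 + 2) = (real n + 3) * fact (n + 2)"
    "fact (Suc n) = (real n + 1) * fact n"
    by (simp_all add: algebra_simps)
  then show ?thesis
    unfolding ballot_def by (simp add: divide_simps) (simp add: algebra_simps)
qed

lemma ballot_rec_Suc: "ballot (Suc n) (Suc k) = ballot (Suc n) k + ballot n (k + 2)"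
proof -
  \<comment> \<open>All factorials except \<open>fact n\<close> are rational multiples of \<open>A\<close> and \<open>B\<close>.\<close>
  define A where "A = (fact (2 * n + k + 3) :: real)"
  define B where "B = (fact (n + k + 3) :: real)"
  have e: "(fact (2 * Suc n + Suc k + 1) :: real) = (2 * real n + real k + 4) * A"
    "(fact (2 * Suc n + k + 1) :: real) = A"
    "(fact (2 * n + (k + 2) + 1) :: real) = A"
    "(fact (Suc n + Suc k + 2) :: real) = (real n + real k + 4) * B"
    "(fact (Suc n + k + 2) :: real) = B"
    "(fact (n + (k + 2) + 2) :: real) = (real n + real k + 4) * B"
    "(fact (Suc n) :: real) = (real n + 1) * fact n"
    by (simp_all add: algebra_simps A_def B_def eval_nat_numeral)
  have "B > 0" by (simp add: B_def)
  then show ?thesis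
    unfolding ballot_def e by (simp add: divide_simps) (simp add: algebra_simps)
qed

text \<open>
  The inner induction on \<open>k\<close> replaces the sum over all \<open>j \<le> k + 1\<close> by its last summand, since
  raising \<open>k\<close> by one adds only the term for the height \<open>k + 2\<close>.
\<close>

lemma num_paths_eq_ballot: "real (num_paths (Suc n) k) = ballot n k"
proof (induction n arbitrary: k)
  case 0
  have "num_paths (Suc 0) k = 1"
    by (simp add: num_paths_Suc num_paths_0)
  moreover have "ballot 0 k = 1"
  proof -
    have "(fact (k + 2) :: real) = (real k + 2) * fact (k + 1)"
      by (simp add: algebra_simps)
    then show ?thesis by (simp add: ballot_def del: fact_Suc)
  qed
  ultimately show ?case by simp
next
  case (Suc n)
  note IH = Suc.IH
  show ?case
  proof (induction k)
    case 0
    then show ?case by (simp add: num_paths_Suc[of "Suc n"] IH ballot_rec_0)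
  next
    case (Suc k)
    have "num_paths (Suc (Suc n)) (Suc k) = num_paths (Suc (Suc n)) k + num_paths (Suc n) (k + 2)"
      by (simp add: num_paths_Suc[of "Suc n"])
    then show ?case
      using Suc.IH IH[of "k + 2"] by (simp only: of_nat_add ballot_rec_Suc)
  qed
qed

section \<open>The series of Lukasiewicz paths\<close>

lemma sqrt_fps_power2: "sqrt_fps ^ 2 = 1 - 4 * fps_X"
proof -
  have "(1 - 4 * fps_X :: real fps) $ 0 = 1" by simp
  then show ?thesis
    using power_radical[of "1 - 4 * fps_X :: real fps" root 1]
    by (simp add: sqrt_fps_def numeral_2_eq_2)
qed

lemma sqrt_fps_nth_0: "sqrt_fps $ 0 = 1"
  by (simp add: sqrt_fps_def)

text \<open>
  The quotient defining \<open>L_fps\<close> is exact because the square root has constant term 1, so that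
  \<open>1 - sqrt_fps\<close> is divisible by \<open>2 * fps_X\<close>.
\<close>

lemma sqrt_fps_eq: "sqrt_fps = 1 - 2 * fps_X * L_fps"
proof -
  have "(2 * fps_X :: real fps) dvd 1 - sqrt_fps"
  proof
    show "1 - sqrt_fps = 2 * fps_X * (fps_const (1 / 2) * fps_shift 1 (1 - sqrt_fps))"
    proof (rule fps_ext)
      fix n
      have "(2 * fps_X * (fps_const (1 / 2) * fps_shift 1 (1 - sqrt_fps))) $ n =
          (fps_X * fps_shift 1 (1 - sqrt_fps)) $ n"
        by (simp add: fps_numeral_fps_const mult.assoc mult.left_commute[of fps_X])
      then show "(1 - sqrt_fps) $ n =
          (2 * fps_X * (fps_const (1 / 2) * fps_shift 1 (1 - sqrt_fps))) $ n"
        by (cases n) (simp_all add: sqrt_fps_nth_0)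
    qed
  qed
  then show ?thesis by (simp add: L_fps_def)
qed

lemma L_fps_eq: "L_fps = 1 + fps_X * L_fps ^ 2"
proof -
  have "4 * fps_X * (1 + fps_X * L_fps ^ 2 - L_fps) = 0"
    using sqrt_fps_power2 unfolding sqrt_fps_eq
    by (simp add: power2_eq_square algebra_simps)
  then show ?thesis by (metis (no_types, lifting) fps_X_neq_zero mult_eq_0_iff zero_neq_numeral eq_iff_diff_eq_0)
qed

text \<open>Sum of the differences \<open>L\<^bsup>j+2\<^esup> - L\<^bsup>j+1\<^esup> = z L\<^bsup>j+3\<^esup>\<close>, starting from \<open>L - 1 = z L\<^sup>2\<close>.\<close>

lemma L_fps_power_telescope:
  "L_fps ^ Suc k = 1 + fps_X * (\<Sum>j\<le>k. L_fps ^ (j + 2))"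
proof (induction k)
  case 0
  show ?case using L_fps_eq by (simp add: power2_eq_square)
next
  case (Suc k)
  have "L_fps ^ Suc (Suc k) = L_fps ^ Suc k * (1 + fps_X * L_fps ^ 2)"
    using L_fps_eq by (metis power_Suc2)
  also have "\<dots> = L_fps ^ Suc k + fps_X * L_fps ^ (Suc k + 2)"
    by (simp add: algebra_simps power_add power2_eq_square)
  finally show ?case by (simp only: Suc.IH sum.atMost_Suc distrib_left add.assoc)
qed

text \<open>
  Both sides satisfy the last-step recurrence, and the factor \<open>fps_X\<close> in it makes the coefficients of
  degree \<open>n + 1\<close> depend only on those of degree \<open>n\<close>; this gives equality by induction on \<open>n\<close>.
\<close>

lemma Total_gf_nth_L: "Total_gf $ k = of_bool (k = 0) + fps_X * L_fps ^ (k + 2)"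
proof (rule fps_ext)
  fix n
  define A where "A = (\<lambda>k. of_bool (k = 0) + fps_X * L_fps ^ (k + 2))"
  have rec: "A k = of_bool (k = 0) + fps_X * (\<Sum>j\<le>Suc k. A j)" for k
  proof -
    have "(\<Sum>j\<le>Suc k. A j) = 1 + fps_X * (\<Sum>j\<le>Suc k. L_fps ^ (j + 2))"
      by (simp add: A_def sum.distrib sum_distrib_left del: sum.atMost_Suc)
    also have "\<dots> = L_fps ^ (k + 2)"
      using L_fps_power_telescope[of "Suc k"] by simp
    finally show ?thesis by (simp add: A_def)
  qed
  have "A k $ n = real (num_paths n k)" for k
  proof (induction n arbitrary: k)
    case 0
    show ?case by (subst rec) (simp add: num_paths_0)
  next
    case (Suc n)
    show ?case
      by (subst rec) (simp add: Suc fps_sum_nth num_paths_Suc)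
  qed
  then show "Total_gf $ k $ n = (of_bool (k = 0) + fps_X * L_fps ^ (k + 2)) $ n"
    by (simp add: Total_gf_nth A_def)
qed

section \<open>The bivariate generating function\<close>

text \<open>
  Stated for coefficients in a ring, since here they are themselves power series: the divisor only
  has to have an invertible constant term.
\<close>

lemma fps_divide_eqI:
  fixes f g h :: "'a :: {comm_ring_1, inverse} fps"
  assumes "g $ 0 * inverse (g $ 0) = 1" and "h * g = f"
  shows "f / g = h"
proof -
  have "g $ 0 \<noteq> 0" using assms(1) by auto
  then have "f / g = h * (g * inverse g)"
    by (simp add: fps_divide_def assms(2)[symmetric] mult.assoc)
  moreover have "g * inverse g = 1"
    unfolding fps_inverse_def by (rule fps_right_inverse) (rule assms(1))
  ultimately show ?thesis by simp
qed

lemma nth_mult_linear: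
  fixes f :: "'a :: comm_ring_1 fps"
  shows "(f * (2 * fps_X - fps_const c)) $ k = 2 * (if k = 0 then 0 else f $ (k - 1)) - f $ k * c"
proof -
  have "f * (2 * fps_X - fps_const c) = fps_X * f + fps_X * f - f * fps_const c"
    by (simp add: algebra_simps)
  then show ?thesis by (simp only: fps_sub_nth fps_add_nth fps_X_mult_nth fps_mult_right_const_nth) simp
qed

text \<open>
  With \<open>S = sqrt_fps = 1 - 2zL\<close> and \<open>L (1 - zL) = 1\<close>, the fraction is
  \<open>-2zL / (2u - 2(1 - zL)) = z L\<^sup>2 / (1 - uL)\<close>, the geometric series with coefficients \<open>z L\<^bsup>k+2\<^esup>\<close>.
  The proof multiplies this series by the denominator and compares coefficients of \<open>u\<^bsup>k\<^esup>\<close>, which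
  telescope to zero for \<open>k > 0\<close>.
\<close>

lemma Total_gf_closed_form:
  "Total_gf = 1 + (- 1 + fps_const sqrt_fps) / (2 * fps_X - 1 - fps_const sqrt_fps)"
proof -
  let ?D = "2 * fps_X - 1 - fps_const sqrt_fps :: real fps fps"
  have D0: "?D $ 0 = - 1 - sqrt_fps" by simp
  have "(- 1 + fps_const sqrt_fps) / ?D = Total_gf - 1"
  proof (rule fps_divide_eqI)
    show "?D $ 0 * inverse (?D $ 0) = 1"
      unfolding D0 by (rule inverse_mult_eq_1') (simp add: sqrt_fps_nth_0)
    have L: "L_fps * (1 - fps_X * L_fps) = 1"
      using L_fps_eq by (simp add: algebra_simps power2_eq_square)
    have T: "(Total_gf - 1) $ k = fps_X * L_fps ^ (k + 2)" for k
      by (simp add: Total_gf_nth_L)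
    have D: "?D = 2 * fps_X - fps_const (2 * (1 - fps_X * L_fps))"
      by (rule fps_ext) (simp add: sqrt_fps_eq algebra_simps)
    show "(Total_gf - 1) * ?D = - 1 + fps_const sqrt_fps"
    proof (rule fps_ext)
      fix k
      have "((Total_gf - 1) * ?D) $ k =
          2 * (if k = 0 then 0 else (Total_gf - 1) $ (k - 1))
          - (Total_gf - 1) $ k * (2 * (1 - fps_X * L_fps))"
        unfolding D by (rule nth_mult_linear)
      moreover have "(Total_gf - 1) $ k * (2 * (1 - fps_X * L_fps)) =
          2 * fps_X * L_fps ^ (k + 1) * (L_fps * (1 - fps_X * L_fps))"
        unfolding T by (simp add: algebra_simps)
      ultimately show "((Total_gf - 1) * ?D) $ k = (- 1 + fps_const sqrt_fps) $ k"
        unfolding T L by (cases k) (simp_all add: sqrt_fps_eq)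
    qed
  qed
  then show ?thesis by simp
qed

section \<open>Explicit coefficients\<close>

lemma binom_nat: "a = int m \<Longrightarrow> b = int l \<Longrightarrow> binom a b = real (m choose l)"
  by (simp add: binom_def binomial_gbinomial)

lemma binom_neg: "b < 0 \<Longrightarrow> binom a b = 0"
  by (simp add: binom_def)

lemma Total_gf_coeff:
  assumes "n \<ge> 1"
  shows "Total_gf $ k $ n =
    (real k + 2) / (real n + real k + 1) * binom (2 * int n + int k - 1) (int n - 1)"
proof -
  obtain m where n: "n = Suc m" using assms by (cases n) auto
  have "binom (2 * int n + int k - 1) (int n - 1) = real ((2 * m + k + 1) choose m)"
    by (rule binom_nat) (simp_all add: n)
  moreover have "real m + real k + 2 = real n + real k + 1"
    by (simp add: n)
  moreover have "Total_gf $ k $ n = ballot m k"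
    by (simp only: n Total_gf_nth num_paths_eq_ballot)
  ultimately show ?thesis by (simp only: ballot_binomial)
qed

lemma G_gf_coeff:
  assumes "n \<ge> 1"
  shows "G_gf $ k $ n =
    (real k + 3) / (real n + real k + 1) * binom (2 * int n + int k - 2) (int n - 2)"
proof (cases "n = 1")
  case True
  then show ?thesis using G_gf_nth_Suc[of k 0] by (simp add: num_paths_0 binom_neg)
next
  case False
  define m where "m = n - 2"
  have n: "n = Suc (Suc m)" using assms False by (simp add: m_def)
  have "binom (2 * int n + int k - 2) (int n - 2) = real ((2 * m + Suc k + 1) choose m)"
    by (rule binom_nat) (simp_all add: n)
  moreover have "real (Suc k) + 2 = real k + 3" "real m + real (Suc k) + 2 = real n + real k + 1"
    by (simp_all add: n)
  moreover have "G_gf $ k $ n = ballot m (Suc k)"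
    by (simp only: n G_gf_nth_Suc num_paths_eq_ballot)
  ultimately show ?thesis by (simp only: ballot_binomial)
qed

lemma H_gf_coeff:
  assumes "n \<ge> 1"
  shows "H_gf $ k $ n =
    (if n = 1 \<and> k = 0 then 1
     else (real k + 2) / (real n + real k) * binom (2 * int n + int k - 3) (int n - 2))"
proof (cases "n = 1")
  case True
  then show ?thesis using H_gf_nth_Suc[of k 0] by (simp add: num_paths_0 binom_neg)
next
  case False
  define m where "m = n - 2"
  have n: "n = Suc (Suc m)" using assms False by (simp add: m_def)
  have "binom (2 * int n + int k - 3) (int n - 2) = real ((2 * m + k + 1) choose m)"
    by (rule binom_nat) (simp_all add: n)
  moreover have "real m + real k + 2 = real n + real k"
    by (simp add: n)
  moreover have "H_gf $ k $ n = ballot m k"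
    by (simp only: n H_gf_nth_Suc num_paths_eq_ballot)
  ultimately show ?thesis using False by (simp only: ballot_binomial) simp
qed

text \<open>
  Number of paths of length \<open>m + 2\<close> ending at height \<open>k\<close> with an up-step: all of them, less those
  whose last step is horizontal and those whose last step is a down-step.
\<close>

lemma ballot_diff:
  "ballot (Suc m) k - ballot m k - ballot m (Suc k) =
     real k / (real m + real k + 1) * real ((2 * m + k + 1) choose Suc m)"
proof -
  \<comment> \<open>All factorials except \<open>fact m\<close> are rational multiples of \<open>A\<close> and \<open>B\<close>.\<close>
  define A where "A = (fact (2 * m + k + 1) :: real)"
  define B where "B = (fact (m + k) :: real)"
  have e: "(fact (2 * Suc m + k + 1) :: real) = (2 * real m + real k + 3) * (2 * real m + real k + 2) * A"
    "(fact (2 * m + k + 1) :: real) = A"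
    "(fact (2 * m + Suc k + 1) :: real) = (2 * real m + real k + 2) * A"
    "(fact (Suc m + k + 2) :: real) =
       (real m + real k + 3) * (real m + real k + 2) * (real m + real k + 1) * B"
    "(fact (m + k + 2) :: real) = (real m + real k + 2) * (real m + real k + 1) * B"
    "(fact (m + Suc k + 2) :: real) =
       (real m + real k + 3) * (real m + real k + 2) * (real m + real k + 1) * B"
    "(fact (Suc m) :: real) = (real m + 1) * fact m"
    by (simp_all add: algebra_simps A_def B_def eval_nat_numeral)
  have "2 * m + k + 1 - Suc m = m + k" by simp
  then have "real ((2 * m + k + 1) choose Suc m) = fact (2 * m + k + 1) / (fact (Suc m) * fact (m + k))"
    using binomial_fact[of "Suc m" "2 * m + k + 1", where ?'a = real] by (simp del: fact_Suc)
  then have C: "real ((2 * m + k + 1) choose Suc m) = A / ((real m + 1) * fact m * B)"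
    by (simp only: e B_def)
  \<comment> \<open>Over the common denominator, only an identity of polynomials in \<open>m\<close> and \<open>k\<close> remains.\<close>
  define p where "p = real m + real k + 1"
  define W where "W = A / ((real m + 1) * fact m * ((p + 2) * (p + 1) * p * B))"
  have nz: "p \<noteq> 0" "p + 1 \<noteq> 0" "p + 2 \<noteq> 0" "real m + 1 \<noteq> 0" "B \<noteq> 0"
    by (auto simp: p_def B_def add_eq_0_iff)
  have p: "real m + real k + 3 = p + 2" "real m + real k + 2 = p + 1" "real m + real k + 1 = p"
    by (simp_all add: p_def)
  have "ballot (Suc m) k = (real k + 2) * (2 * real m + real k + 3) * (2 * real m + real k + 2) * W"
    unfolding ballot_def e p W_def by (simp add: mult.assoc)
  moreover have "ballot m k = (real k + 2) * (real m + 1) * (p + 2) * W"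
    unfolding ballot_def e p W_def using nz by simp
  moreover have "ballot m (Suc k) = (real k + 3) * (2 * real m + real k + 2) * (real m + 1) * W"
    unfolding ballot_def e p W_def using nz by (simp add: add.commute mult.assoc)
  moreover have "real k / p * (A / ((real m + 1) * fact m * B)) = real k * (p + 1) * (p + 2) * W"
    unfolding W_def using nz by simp
  moreover have "(real k + 2) * (2 * real m + real k + 3) * (2 * real m + real k + 2)
      - (real k + 2) * (real m + 1) * (p + 2)
      - (real k + 3) * (2 * real m + real k + 2) * (real m + 1) = real k * (p + 1) * (p + 2)"
    unfolding p_def by (simp add: algebra_simps)
  ultimately show ?thesis
    unfolding C p by (metis left_diff_distrib)
qed

lemma F_gf_coeff:
  assumes "n \<ge> 1"
  shows "F_gf $ k $ n =
    real k / (real n + real k - 1) * binom (2 * int n + int k - 3) (int n - 1)"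
proof (cases "n = 1")
  case True
  have "F_gf $ k $ n = of_bool (k > 0)"
    using F_gf_nth_Suc[of k 0] True by (simp add: num_paths_Suc num_paths_0)
  \<comment> \<open>The binomial coefficient is 1, and \<open>k / k\<close> is 1 for \<open>k > 0\<close> and 0 for \<open>k = 0\<close>.\<close>
  then show ?thesis by (simp add: True binom_def)
next
  case False
  define m where "m = n - 2"
  have n: "n = Suc (Suc m)" using assms False by (simp add: m_def)
  have "binom (2 * int n + int k - 3) (int n - 1) = real ((2 * m + k + 1) choose Suc m)"
    by (rule binom_nat) (simp_all add: n)
  moreover have "real m + real k + 1 = real n + real k - 1"
    by (simp add: n)
  moreover have "F_gf $ k $ n = ballot (Suc m) k - ballot m k - ballot m (Suc k)"
    by (simp only: n F_gf_nth_Suc num_paths_eq_ballot)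
  ultimately show ?thesis by (simp only: ballot_diff)
qed

theorem theorem1:
  shows "Total_gf = 1 + (- 1 + fps_const sqrt_fps) / (2 * fps_X - 1 - fps_const sqrt_fps)
    \<and> (\<forall>k. Total_gf $ k = of_bool (k = 0) + fps_X * L_fps ^ (k + 2))
    \<and> (\<forall>n k. n \<ge> 1 \<longrightarrow>
         Total_gf $ k $ n =
           (real k + 2) / (real n + real k + 1) * binom (2 * int n + int k - 1) (int n - 1)
       \<and> F_gf $ k $ n =
           real k / (real n + real k - 1) * binom (2 * int n + int k - 3) (int n - 1)
       \<and> G_gf $ k $ n =
           (real k + 3) / (real n + real k + 1) * binom (2 * int n + int k - 2) (int n - 2)
       \<and> H_gf $ k $ n =
           (if n = 1 \<and> k = 0 then 1
            else (real k + 2) / (real n + real k) * binom (2 * int n + int k - 3) (int n - 2)))"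
  using Total_gf_closed_form Total_gf_nth_L Total_gf_coeff F_gf_coeff G_gf_coeff H_gf_coeff
  by blast

end
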